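(* Let $1\le \ell\le u$ be integers and $\theta=\frac{u}{\ell}$. The approximation factor of Double Proposal for the uniform model, i.e. over all instances $I$ of HRT-MSLQ in which every hospital has lower quota $\ell$ and upper quota $u$, satisfies $$\max_{I}\frac{\mathrm{OPT}(I)}{\mathrm{ALG}(I)}=\frac{\theta^2+\theta-1}{2\theta-1}.$$
   Context: Problem. An instance $I$ of HRT-MSLQ consists of a set $R=\{r_1,\dots,r_n\}$ of residents ($n\ge 1$) and a set $H=\{h_1,\dots,h_m\}$ of hospitals (agents are indexed). Each resident $r$ has a complete preference list over $H$ that may contain ties (a total preorder $\succeq_r$; $\succ_r$ is strict preference, $=_r$ indifference), and each hospital $h$ likewise has a complete preference list over $R$ that may contain ties. Each hospital $h$ has an integer lower quota $\ell(h)$ and upper quota $u(h)$ with $0\le \ell(h)\le u(h)\le n$, $u(h)\ge 1$. Standing assumption: $|R|<\sum_{h\in H}u(h)$. An assignment is a set $M\subseteq R\times H$; $M(r)=\{h:(r,h)\in M\}$, $M(h)=\{r:(r,h)\in M\}$. $M$ is a matching if $|M(r)|\le 1$ for all $r$ and $|M(h)|\le u(h)$ for all $h$; then $M(r)$ also denotes the unique hospital of a matched resident $r$. A pair $(r,h)$ blocks a matching $M$ if (i) $r$ is unmatched in $M$ or $h\succ_r M(r)$, and (ii) $|M(h)|<u(h)$ or $h$ strictly prefers $r$ to at least one resident in $M(h)$. $M$ is stable if no pair blocks it. The score of $h$ in $M$ is $s_M(h)=\min\{1,|M(h)|/\ell(h)\}$, with $s_M(h)=1$ if $\ell(h)=0$;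 the score of $M$ is $s(M)=\sum_{h\in H}s_M(h)$. $\mathrm{OPT}(I)$ is the maximum of $s(M)$ over stable matchings $M$ of $I$. $\mathrm{ALG}(I)$ is the score of the output of Double Proposal on $I$. Algorithm Double Proposal (deterministic). Regard a hospital not in any tie of a resident's list as a tie of length one. Start with $M:=\emptyset$. While some resident is unmatched in $M$: let $r$ be the unmatched resident with smallest index and $T$ the top tie of $r$'s current list. If $T$ contains a hospital to which $r$ has not yet proposed, let $h$ be such a hospital with minimum $\ell(h)$; otherwise let $h$ be a hospital in $T$ with minimum $\ell(h)$ (in both cases break remaining ties by smallest hospital index). Resident $r$ proposes to $h$, and then: (1) if $|M(h)|<\ell(h)$, set $M:=M\cup\{(r,h)\}$; (2) else, if some resident in $M(h)\cup\{r\}$ has not been rejected by $h$ so far, let $r'$ be the one among such residents with the largest index (possibly $r'=r$) and set $M:=(M\cup\{(r,h)\})\setminus\{(r',h)\}$; (3) else, if $|M(h)|<u(h)$, set $M:=M\cup\{(r,h)\}$; (4) else, let $r'$ be a resident in $M(h)\cup\{r\}$ that is worst for $h$ (the one with largest index if there are several; possibly $r'=r$), set $M:=(M\cup\{(r,h)\})\setminus\{(r',h)\}$, and delete $h$ from the list of $r'$. In (2) and (4), $r'$ is said to be rejected by $h$. When no resident is unmatched, output $M$. (The output is a stable matching.) *)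

theory Defs
  imports Complex_Main "HOL-Library.While_Combinator"
begin

section \<open>Instances of HRT-MSLQ\<close>

text \<open>
  Resident \<open>r\<^sub>i\<close> and hospital \<open>h\<^sub>j\<close> are identified with their indices \<open>i\<close> and \<open>j\<close>, counted from 1.
  A preference list with ties is a total preorder, stored as a set of pairs:
  \<open>(a, b)\<close> is in the relation iff \<open>a\<close> is weakly preferred to \<open>b\<close>.
\<close>

record hrt =
  num_res :: nat
  num_hosp :: nat
  res_pref :: "nat \<Rightarrow> nat rel"
  hosp_pref :: "nat \<Rightarrow> nat rel"
  lower :: "nat \<Rightarrow> nat"
  upper :: "nat \<Rightarrow> nat"

definition residents :: "hrt \<Rightarrow> nat set" where
  "residents I = {1..num_res I}"

definition hospitals :: "hrt \<Rightarrow> nat set" where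
  "hospitals I = {1..num_hosp I}"

definition total_preorder_on :: "'a set \<Rightarrow> 'a rel \<Rightarrow> bool" where
  "total_preorder_on A P \<longleftrightarrow> preorder_on A P \<and> total_on A P"

definition strictly_prefers :: "'a rel \<Rightarrow> 'a \<Rightarrow> 'a \<Rightarrow> bool" where
  "strictly_prefers P a b \<longleftrightarrow> (a, b) \<in> P \<and> (b, a) \<notin> P"

definition hrt_instance :: "hrt \<Rightarrow> bool" where
  "hrt_instance I \<longleftrightarrow>
     num_res I \<ge> 1 \<and>
     (\<forall>r \<in> residents I. total_preorder_on (hospitals I) (res_pref I r)) \<and>
     (\<forall>h \<in> hospitals I. total_preorder_on (residents I) (hosp_pref I h)) \<and>
     (\<forall>h \<in> hospitals I. lower I h \<le> upper I h \<and> upper I h \<le> num_res I \<and> upper I h \<ge> 1) \<and>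
     num_res I < (\<Sum>h \<in> hospitals I. upper I h)"

definition uniform_instance :: "nat \<Rightarrow> nat \<Rightarrow> hrt \<Rightarrow> bool" where
  "uniform_instance l u I \<longleftrightarrow>
     hrt_instance I \<and> (\<forall>h \<in> hospitals I. lower I h = l \<and> upper I h = u)"

section \<open>Stable matchings and scores\<close>

type_synonym assignment = "(nat \<times> nat) set"

definition hosps_of :: "assignment \<Rightarrow> nat \<Rightarrow> nat set" where
  "hosps_of M r = {h. (r, h) \<in> M}"

definition ress_of :: "assignment \<Rightarrow> nat \<Rightarrow> nat set" where
  "ress_of M h = {r. (r, h) \<in> M}"

definition is_matching :: "hrt \<Rightarrow> assignment \<Rightarrow> bool" where
  "is_matching I M \<longleftrightarrow>
     M \<subseteq> residents I \<times> hospitals I \<and>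
     (\<forall>r \<in> residents I. card (hosps_of M r) \<le> 1) \<and>
     (\<forall>h \<in> hospitals I. card (ress_of M h) \<le> upper I h)"

definition blocks :: "hrt \<Rightarrow> assignment \<Rightarrow> nat \<Rightarrow> nat \<Rightarrow> bool" where
  "blocks I M r h \<longleftrightarrow>
     (hosps_of M r = {} \<or> (\<exists>h' \<in> hosps_of M r. strictly_prefers (res_pref I r) h h')) \<and>
     (card (ress_of M h) < upper I h \<or>
        (\<exists>r' \<in> ress_of M h. strictly_prefers (hosp_pref I h) r r'))"

definition stable_matching :: "hrt \<Rightarrow> assignment \<Rightarrow> bool" where
  "stable_matching I M \<longleftrightarrow>
     is_matching I M \<and> (\<forall>r \<in> residents I. \<forall>h \<in> hospitals I. \<not> blocks I M r h)"

definition hosp_score :: "hrt \<Rightarrow> assignment \<Rightarrow> nat \<Rightarrow> real" where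
  "hosp_score I M h =
     (if lower I h = 0 then 1 else min 1 (real (card (ress_of M h)) / real (lower I h)))"

definition score :: "hrt \<Rightarrow> assignment \<Rightarrow> real" where
  "score I M = (\<Sum>h \<in> hospitals I. hosp_score I M h)"

definition OPT :: "hrt \<Rightarrow> real" where
  "OPT I = Max {score I M | M. stable_matching I M}"

section \<open>The algorithm Double Proposal\<close>

text \<open>
  \<open>proposed\<close> and \<open>rejected\<close> record all pairs \<open>(r, h)\<close> such that \<open>r\<close> has proposed to \<open>h\<close>,
  respectively has been rejected by \<open>h\<close>, so far; \<open>deleted\<close> contains \<open>(r, h)\<close> iff \<open>h\<close> has been
  deleted from the list of \<open>r\<close>.
\<close>

record dp_state =
  matching :: assignment
  proposed :: "(nat \<times> nat) set"
  rejected :: "(nat \<times> nat) set"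
  deleted :: "(nat \<times> nat) set"

definition dp_init :: dp_state where
  "dp_init = \<lparr>matching = {}, proposed = {}, rejected = {}, deleted = {}\<rparr>"

definition unmatched :: "hrt \<Rightarrow> dp_state \<Rightarrow> nat set" where
  "unmatched I s = {r \<in> residents I. hosps_of (matching s) r = {}}"

definition current_list :: "hrt \<Rightarrow> dp_state \<Rightarrow> nat \<Rightarrow> nat set" where
  "current_list I s r = {h \<in> hospitals I. (r, h) \<notin> deleted s}"

definition top_tie :: "hrt \<Rightarrow> dp_state \<Rightarrow> nat \<Rightarrow> nat set" where
  "top_tie I s r =
     {h \<in> current_list I s r. \<forall>h' \<in> current_list I s r. (h, h') \<in> res_pref I r}"

definition min_lower :: "hrt \<Rightarrow> nat set \<Rightarrow> nat" where
  "min_lower I C = Min {h \<in> C. \<forall>h' \<in> C. lower I h \<le> lower I h'}"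

definition proposal_target :: "hrt \<Rightarrow> dp_state \<Rightarrow> nat \<Rightarrow> nat" where
  "proposal_target I s r =
     (let T = top_tie I s r; F = {h \<in> T. (r, h) \<notin> proposed s}
      in if F \<noteq> {} then min_lower I F else min_lower I T)"

definition worst_for :: "hrt \<Rightarrow> nat \<Rightarrow> nat set \<Rightarrow> nat" where
  "worst_for I h A = Max {r \<in> A. \<forall>r' \<in> A. (r', r) \<in> hosp_pref I h}"

definition respond :: "hrt \<Rightarrow> nat \<Rightarrow> nat \<Rightarrow> dp_state \<Rightarrow> dp_state" where
  "respond I r h s =
     (let M = matching s;
          A = insert r (ress_of M h);
          N = {x \<in> A. (x, h) \<notin> rejected s}
      in if card (ress_of M h) < lower I h then
           s\<lparr>matching := insert (r, h) M\<rparr>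
         else if N \<noteq> {} then
           (let r' = Max N in
            s\<lparr>matching := insert (r, h) M - {(r', h)},
              rejected := insert (r', h) (rejected s)\<rparr>)
         else if card (ress_of M h) < upper I h then
           s\<lparr>matching := insert (r, h) M\<rparr>
         else
           (let r' = worst_for I h A in
            s\<lparr>matching := insert (r, h) M - {(r', h)},
              rejected := insert (r', h) (rejected s),
              deleted := insert (r', h) (deleted s)\<rparr>))"

definition dp_step :: "hrt \<Rightarrow> dp_state \<Rightarrow> dp_state" where
  "dp_step I s =
     (let r = Min (unmatched I s); h = proposal_target I s r
      in respond I r h (s\<lparr>proposed := insert (r, h) (proposed s)\<rparr>))"

text \<open>
  On every \<open>hrt_instance\<close> the loop terminates and no current list becomes empty, because
  the number of residents is less than the sum of the upper quotas; hence \<open>while\<close> returns the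
  final state and all \<open>Min\<close> and \<open>Max\<close> above are taken over nonempty sets.
\<close>

definition double_proposal :: "hrt \<Rightarrow> assignment" where
  "double_proposal I = matching (while (\<lambda>s. unmatched I s \<noteq> {}) (dp_step I) dp_init)"

definition ALG :: "hrt \<Rightarrow> real" where
  "ALG I = score I (double_proposal I)"

definition is_maximum_of :: "real \<Rightarrow> real set \<Rightarrow> bool" where
  "is_maximum_of c S \<longleftrightarrow> c \<in> S \<and> (\<forall>x \<in> S. x \<le> c)"

end

(*
  Upper bound. Let M be the output, N a stable matching, both of which match every resident.
  A resident moving in N to a hospital with M-load below l cannot come from a hospital h with
  M-load above l unless h is full in N: a strict preference would block M or N, and in a tie she
  has been rejected by h, hence has proposed to and been rejected by the whole tie. Let Q be the
  set of hospitals with M-load above l that are not full in N, C the set of the other hospitals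
  with M-load at least l, and D = l (s(N) - s(M)). Comparing the excess loads above l gives
  D <= (u - l) |Q|; counting the residents that move to hospitals below their lower quota gives
  D <= u |C|. As l s(M) >= l (|Q| + |C|), adding u times the first to u - l times the second
  bound yields l (2u - l) (s(N) - s(M)) <= u (u - l) s(M).

  Tightness. Make both bounds sharp: u hospitals in Q go from load u to l, their leavers fill the
  u - l hospitals of C, and the former residents of C go to empty hospitals.
*)

theory Submission
  imports Defs
begin

section \<open>Total preorders\<close>

lemma total_preorder_onD:
  assumes "total_preorder_on A P"
  shows "\<And>a. a \<in> A \<Longrightarrow> (a, a) \<in> P"
    and "\<And>a b c. (a, b) \<in> P \<Longrightarrow> (b, c) \<in> P \<Longrightarrow> (a, c) \<in> P"
    and "\<And>a b. a \<in> A \<Longrightarrow> b \<in> A \<Longrightarrow> (a, b) \<in> P \<or> (b, a) \<in> P"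
proof -
  have refl: "refl_on A P" and trans: "trans P" and total: "total_on A P"
    using assms by (auto simp: total_preorder_on_def preorder_on_def)
  show 1: "(a, a) \<in> P" if "a \<in> A" for a
    using refl that by (auto simp: refl_on_def)
  show "(a, c) \<in> P" if "(a, b) \<in> P" "(b, c) \<in> P" for a b c
    using trans that by (auto elim: transE)
  show "(a, b) \<in> P \<or> (b, a) \<in> P" if "a \<in> A" "b \<in> A" for a b
    using total 1 that by (cases "a = b") (auto simp: total_on_def)
qed

lemma total_preorder_on_converse:
  "total_preorder_on A P \<Longrightarrow> total_preorder_on A (P\<inverse>)"
  by (auto simp: total_preorder_on_def preorder_on_def refl_on_def total_on_def)

text \<open>Serves \<open>worst_for\<close> directly and, applied to the converse relation, the top
  tie of a resident's list.\<close>

lemma total_preorder_on_worst: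
  assumes P: "total_preorder_on A P" and "finite B" "B \<noteq> {}" "B \<subseteq> A"
  obtains w where "w \<in> B" "\<And>x. x \<in> B \<Longrightarrow> (x, w) \<in> P"
proof -
  note tp = total_preorder_onD[OF P]
  from assms(2-4) have "\<exists>w\<in>B. \<forall>x\<in>B. (x, w) \<in> P"
  proof (induction B rule: finite_ne_induct)
    case (singleton x)
    then show ?case using tp(1) by auto
  next
    case (insert y B)
    then obtain w where w: "w \<in> B" "\<forall>x\<in>B. (x, w) \<in> P" by auto
    show ?case
    proof (cases "(y, w) \<in> P")
      case True
      then show ?thesis using w by blast
    next
      case False
      then have "(w, y) \<in> P" using tp(3)[of y w] insert.prems w(1) by auto
      then have "\<forall>x\<in>insert y B. (x, y) \<in> P" 
        using w(2) insert.prems tp(1,2) by blast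
      then show ?thesis by blast
    qed
  qed
  then show thesis using that by blast
qed

section \<open>Loads of assignments\<close>

lemma ress_of_iff: "r \<in> ress_of M h \<longleftrightarrow> (r, h) \<in> M"
  by (simp add: ress_of_def)

lemma hosps_of_iff: "h \<in> hosps_of M r \<longleftrightarrow> (r, h) \<in> M"
  by (simp add: hosps_of_def)

lemma finite_residents [simp]: "finite (residents I)"
  and finite_hospitals [simp]: "finite (hospitals I)"
  by (simp_all add: residents_def hospitals_def)

lemma ress_of_subset: "M \<subseteq> residents I \<times> hospitals I \<Longrightarrow> ress_of M h \<subseteq> residents I"
  by (auto simp: ress_of_def)

lemma finite_ress_of: "M \<subseteq> residents I \<times> hospitals I \<Longrightarrow> finite (ress_of M h)"
  using ress_of_subset finite_subset finite_residents by metis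

lemma is_matching_iff:
  "is_matching I M \<longleftrightarrow> M \<subseteq> residents I \<times> hospitals I \<and>
     (\<forall>r h h'. (r, h) \<in> M \<longrightarrow> (r, h') \<in> M \<longrightarrow> h = h') \<and>
     (\<forall>h\<in>hospitals I. card (ress_of M h) \<le> upper I h)"
proof -
  have "(\<forall>r\<in>residents I. card (hosps_of M r) \<le> 1) \<longleftrightarrow>
        (\<forall>r h h'. (r, h) \<in> M \<longrightarrow> (r, h') \<in> M \<longrightarrow> h = h')"
    if M: "M \<subseteq> residents I \<times> hospitals I"
  proof -
    have fin: "finite (hosps_of M r)" for r
      by (rule finite_subset[of _ "hospitals I"]) (use M in \<open>auto simp: hosps_of_def\<close>)
    have "card (hosps_of M r) \<le> 1 \<longleftrightarrow> (\<forall>h h'. (r, h) \<in> M \<longrightarrow> (r, h') \<in> M \<longrightarrow> h = h')" for r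
      using card_le_Suc0_iff_eq[OF fin[of r]] by (auto simp: hosps_of_iff)
    then show ?thesis using M by blast
  qed
  then show ?thesis unfolding is_matching_def by blast
qed

lemma sum_loads_eq_card:
  assumes "is_matching I M" "A \<subseteq> hospitals I"
  shows "(\<Sum>h\<in>A. card (ress_of M h)) = card (\<Union>h\<in>A. ress_of M h)"
proof (rule card_UN_disjoint[symmetric])
  show "finite A" using assms(2) finite_subset finite_hospitals by blast
  show "\<forall>h\<in>A. finite (ress_of M h)"
    using assms(1) finite_ress_of by (auto simp: is_matching_def)
  show "\<forall>h\<in>A. \<forall>h'\<in>A. h \<noteq> h' \<longrightarrow> ress_of M h \<inter> ress_of M h' = {}"
    using assms(1) by (fastforce simp: is_matching_iff ress_of_def)
qed

lemma sum_loads_le: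
  assumes "is_matching I M"
  shows "(\<Sum>h\<in>hospitals I. card (ress_of M h)) \<le> num_res I"
proof -
  have "(\<Union>h\<in>hospitals I. ress_of M h) \<subseteq> residents I"
    using assms by (auto simp: is_matching_def ress_of_def)
  then have "card (\<Union>h\<in>hospitals I. ress_of M h) \<le> card (residents I)"
    by (rule card_mono[rotated]) simp
  then show ?thesis using sum_loads_eq_card[OF assms] by (simp add: residents_def)
qed

lemma ex_undersubscribed:
  assumes "hrt_instance I" "is_matching I M"
  obtains h where "h \<in> hospitals I" "card (ress_of M h) < upper I h"
proof -
  have "(\<Sum>h\<in>hospitals I. card (ress_of M h)) < (\<Sum>h\<in>hospitals I. upper I h)"
    using sum_loads_le[OF assms(2)] assms(1) by (simp add: hrt_instance_def)
  then obtain h where "h \<in> hospitals I" "card (ress_of M h) < upper I h"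
    by (meson not_le sum_mono)
  then show thesis using that by blast
qed

text \<open>An unmatched resident would block with any undersubscribed hospital, and the standing
  assumption on the upper quotas guarantees one.\<close>

lemma stable_matching_complete:
  assumes "hrt_instance I" "stable_matching I M" "r \<in> residents I"
  obtains h where "(r, h) \<in> M"
proof -
  have "hosps_of M r \<noteq> {}"
  proof
    assume "hosps_of M r = {}"
    moreover obtain h where "h \<in> hospitals I" "card (ress_of M h) < upper I h"
      using ex_undersubscribed assms by (metis stable_matching_def)
    ultimately have "blocks I M r h" by (simp add: blocks_def)
    then show False using assms \<open>h \<in> hospitals I\<close> by (simp add: stable_matching_def)
  qed
  then show thesis using that by (auto simp: hosps_of_def)
qed

lemma sum_loads_complete:
  assumes "is_matching I M" "\<And>r. r \<in> residents I \<Longrightarrow> \<exists>h. (r, h) \<in> M"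
  shows "(\<Sum>h\<in>hospitals I. card (ress_of M h)) = num_res I"
proof -
  have M: "M \<subseteq> residents I \<times> hospitals I" using assms(1) by (simp add: is_matching_def)
  have "(\<Union>h\<in>hospitals I. ress_of M h) = residents I"
  proof
    show "(\<Union>h\<in>hospitals I. ress_of M h) \<subseteq> residents I" using ress_of_subset[OF M] by blast
    show "residents I \<subseteq> (\<Union>h\<in>hospitals I. ress_of M h)"
    proof
      fix r assume "r \<in> residents I"
      then obtain h where "(r, h) \<in> M" using assms(2) by blast
      then show "r \<in> (\<Union>h\<in>hospitals I. ress_of M h)" using M by (auto simp: ress_of_iff)
    qed
  qed
  then show ?thesis using sum_loads_eq_card[OF assms(1), of "hospitals I"] by (simp add: residents_def)
qed

section \<open>The invariant of Double Proposal\<close>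

text \<open>The index comparison reflects that step (4) rejects the worst resident of largest index.\<close>

definition ranked_before :: "hrt \<Rightarrow> nat \<Rightarrow> nat \<Rightarrow> nat \<Rightarrow> bool" where
  "ranked_before I h x y \<longleftrightarrow>
     (x, y) \<in> hosp_pref I h \<and> ((y, x) \<in> hosp_pref I h \<longrightarrow> x < y)"

lemma ranked_before_trans:
  assumes "hrt_instance I" "h \<in> hospitals I" "ranked_before I h x y" "ranked_before I h y z"
  shows "ranked_before I h x z"
proof -
  have P: "total_preorder_on (residents I) (hosp_pref I h)"
    using assms by (simp add: hrt_instance_def)
  show ?thesis
    using assms(3,4) total_preorder_onD(2)[OF P] unfolding ranked_before_def
    by (meson less_trans)
qed

lemma worst_for_ranked:
  assumes "hrt_instance I" "h \<in> hospitals I" "A \<subseteq> residents I" "A \<noteq> {}"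
  shows "worst_for I h A \<in> A"
    and "\<And>x. x \<in> A \<Longrightarrow> x \<noteq> worst_for I h A \<Longrightarrow> ranked_before I h x (worst_for I h A)"
proof -
  have P: "total_preorder_on (residents I) (hosp_pref I h)"
    using assms by (simp add: hrt_instance_def)
  have finA: "finite A" using assms(3) finite_subset finite_residents by blast
  define W where "W = {r \<in> A. \<forall>r'\<in>A. (r', r) \<in> hosp_pref I h}"
  have w: "worst_for I h A = Max W" by (simp add: worst_for_def W_def)
  obtain v where "v \<in> A" "\<And>x. x \<in> A \<Longrightarrow> (x, v) \<in> hosp_pref I h"
    using total_preorder_on_worst[OF P finA assms(4,3)] by blast
  then have "W \<noteq> {}" by (auto simp: W_def)
  moreover have finW: "finite W" using finA by (simp add: W_def)
  ultimately have in_W: "worst_for I h A \<in> W" unfolding w by (rule Max_in[rotated])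
  then show "worst_for I h A \<in> A" by (simp add: W_def)
  show "ranked_before I h x (worst_for I h A)" if x: "x \<in> A" "x \<noteq> worst_for I h A" for x
  proof -
    have "x < worst_for I h A" if "(worst_for I h A, x) \<in> hosp_pref I h"
    proof -
      \<comment> \<open>An element as bad as the worst one lies in \<open>W\<close> too, so
        \<open>Max\<close> decides between them by index.\<close>
      have "x \<in> W" using in_W x that total_preorder_onD(2)[OF P] unfolding W_def by blast
      then have "x \<le> worst_for I h A" unfolding w using finW by simp
      then show ?thesis using x(2) by simp
    qed
    then show ?thesis using in_W x by (simp add: ranked_before_def W_def)
  qed
qed

text \<open>\<open>P\<close>, \<open>Rj\<close> and \<open>D\<close> are the proposed, rejected and
  deleted pairs. Loads never decrease, so the load clauses for rejected and deleted pairs persist.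
  \<open>over_rejected\<close> holds because step (3) is reached only when all residents involved
  have been rejected. \<open>deleted_rejected\<close> covers equal quotas, where
  \<open>over_rejected\<close> says nothing about a full hospital. The upper bound rests on
  \<open>tie_rejected\<close>: whoever is held by a hospital that rejected her before has been
  rejected by its whole tie.\<close>

locale dp_invariant =
  fixes I :: hrt and M :: assignment and P Rj D :: "(nat \<times> nat) set"
  assumes inst: "hrt_instance I"
    and M_P: "M \<subseteq> P"
    and M_fun: "\<And>r h h'. (r, h) \<in> M \<Longrightarrow> (r, h') \<in> M \<Longrightarrow> h = h'"
    and load_le: "\<And>h. h \<in> hospitals I \<Longrightarrow> card (ress_of M h) \<le> upper I h"
    and P_sub: "P \<subseteq> residents I \<times> hospitals I"
    and Rj_sub: "Rj \<subseteq> P"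
    and D_sub: "D \<subseteq> Rj"
    and M_D: "M \<inter> D = {}"
    and proposed_cases: "P \<subseteq> M \<union> Rj"
    and over_rejected: "\<And>r h. (r, h) \<in> M \<Longrightarrow> lower I h < card (ress_of M h) \<Longrightarrow> (r, h) \<in> Rj"
    and rejected_load: "\<And>r h. (r, h) \<in> Rj \<Longrightarrow> lower I h \<le> card (ress_of M h)"
    and deleted_load: "\<And>r h. (r, h) \<in> D \<Longrightarrow> card (ress_of M h) = upper I h"
    and deleted_rejected: "\<And>r h x. (r, h) \<in> D \<Longrightarrow> (x, h) \<in> M \<Longrightarrow> (x, h) \<in> Rj"
    and deleted_ranked: "\<And>r h x. (r, h) \<in> D \<Longrightarrow> (x, h) \<in> M \<Longrightarrow> ranked_before I h x r"
    and better_deleted: "\<And>r h h'. (r, h) \<in> M \<Longrightarrow> h' \<in> hospitals I \<Longrightarrow>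
          strictly_prefers (res_pref I r) h' h \<Longrightarrow> (r, h') \<in> D"
    and tie_rejected: "\<And>r h h'. (r, h) \<in> M \<Longrightarrow> (r, h) \<in> Rj \<Longrightarrow> h' \<in> hospitals I \<Longrightarrow>
          (h, h') \<in> res_pref I r \<Longrightarrow> (h', h) \<in> res_pref I r \<Longrightarrow> (r, h') \<in> Rj"
begin

lemma M_sub: "M \<subseteq> residents I \<times> hospitals I"
  using M_P P_sub by blast

lemma matching: "is_matching I M"
  using M_sub M_fun load_le by (auto simp: is_matching_iff)

lemma finite_load: "finite (ress_of M h)"
  using finite_ress_of M_sub by blast

lemma finite_sets: "finite M" "finite Rj" "finite D"
proof -
  have "finite P" by (rule finite_subset[OF P_sub]) simp
  then show "finite M" "finite Rj" using M_P Rj_sub by (auto intro: finite_subset)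
  then show "finite D" using D_sub by (auto intro: finite_subset)
qed

end

section \<open>Effect of a single proposal\<close>

locale dp_proposal = dp_invariant +
  fixes r h :: nat
  assumes r: "r \<in> residents I" and r_free: "\<And>k. (r, k) \<notin> M"
    and h: "h \<in> hospitals I" and h_listed: "(r, h) \<notin> D"
    and better: "\<And>k. k \<in> hospitals I \<Longrightarrow> strictly_prefers (res_pref I r) k h \<Longrightarrow> (r, k) \<in> D"
    and tie: "\<And>k. (r, h) \<in> P \<Longrightarrow> k \<in> hospitals I \<Longrightarrow> (h, k) \<in> res_pref I r \<Longrightarrow>
          (k, h) \<in> res_pref I r \<Longrightarrow> (r, k) \<in> P"
begin

text \<open>Common core of the four responses: everything away from \<open>h\<close> is inherited,
  so only conditions at \<open>h\<close> remain as hypotheses.\<close>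

lemma update:
  assumes M': "M' \<subseteq> insert (r, h) M"
    and off: "\<And>x k. k \<noteq> h \<Longrightarrow> (x, k) \<in> M' \<longleftrightarrow> (x, k) \<in> M"
    and Rj': "Rj \<subseteq> Rj'" "Rj' \<subseteq> insert (r, h) P" "insert (r, h) M \<subseteq> M' \<union> Rj'"
    and new_Rj: "\<And>x k. (x, k) \<in> Rj' \<Longrightarrow> (x, k) \<notin> Rj \<Longrightarrow>
          k = h \<and> (x, h) \<notin> M' \<and> lower I h \<le> card (ress_of M h)"
    and D': "D \<subseteq> D'" "D' \<subseteq> Rj'"
    and new_D: "\<And>x k. (x, k) \<in> D' \<Longrightarrow> (x, k) \<notin> D \<Longrightarrow> k = h \<and> (x, h) \<notin> M'"
    and load: "card (ress_of M h) \<le> card (ress_of M' h)" "card (ress_of M' h) \<le> upper I h"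
    and over: "\<And>x. lower I h < card (ress_of M' h) \<Longrightarrow> (x, h) \<in> M' \<Longrightarrow> (x, h) \<in> Rj'"
    and del_h: "\<And>d x. (d, h) \<in> D' \<Longrightarrow> card (ress_of M' h) = upper I h"
      "\<And>d x. (d, h) \<in> D' \<Longrightarrow> (x, h) \<in> M' \<Longrightarrow> (x, h) \<in> Rj' \<and> ranked_before I h x d"
  shows "dp_invariant I M' (insert (r, h) P) Rj' D'"
proof -
  have ress: "ress_of M' k = ress_of M k" if "k \<noteq> h" for k
    using off that by (auto simp: ress_of_def)
  have mem: "(x, k) \<in> M \<or> x = r \<and> k = h" if "(x, k) \<in> M'" for x k
    using M' that by auto
  show ?thesis
  proof
    show "hrt_instance I" by (rule inst)
    show "M' \<subseteq> insert (r, h) P" using M' M_P by auto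
    show "k = k'" if "(x, k) \<in> M'" "(x, k') \<in> M'" for x k k'
      using mem[OF that(1)] mem[OF that(2)] r_free M_fun by auto
    show "card (ress_of M' k) \<le> upper I k" if "k \<in> hospitals I" for k
      using load(2) load_le[OF that] ress by (cases "k = h") auto
    show "insert (r, h) P \<subseteq> residents I \<times> hospitals I" using P_sub r h by auto
    show "Rj' \<subseteq> insert (r, h) P" by (rule Rj')
    show "D' \<subseteq> Rj'" by (rule D')
    show "M' \<inter> D' = {}"
    proof -
      have False if "(x, k) \<in> M'" "(x, k) \<in> D'" for x k
        using mem[OF that(1)] new_D[OF that(2)] that(1) M_D h_listed by auto
      then show ?thesis by auto
    qed
    show "insert (r, h) P \<subseteq> M' \<union> Rj'" using proposed_cases Rj' by auto
    show "(x, k) \<in> Rj'" if "(x, k) \<in> M'" "lower I k < card (ress_of M' k)" for x k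
      using that over over_rejected off ress Rj'(1) by (cases "k = h") auto
    have load_mono: "card (ress_of M k) \<le> card (ress_of M' k)" for k
      using ress load(1) by (cases "k = h") auto
    show "lower I k \<le> card (ress_of M' k)" if "(x, k) \<in> Rj'" for x k
      using new_Rj[OF that] rejected_load load_mono le_trans by blast
    have old_D: "(x, k) \<in> D" if "(x, k) \<in> D'" "k \<noteq> h" for x k
      using new_D[OF that(1)] that(2) by blast
    show "card (ress_of M' k) = upper I k" if "(x, k) \<in> D'" for x k
      using del_h(1) deleted_load[OF old_D] ress that by (cases "k = h") auto
    show "(y, k) \<in> Rj'" if "(x, k) \<in> D'" "(y, k) \<in> M'" for x k y
      using del_h(2) deleted_rejected[OF old_D] off Rj'(1) that by (cases "k = h") auto
    show "ranked_before I k y x" if "(x, k) \<in> D'" "(y, k) \<in> M'" for x k y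
      using del_h(2) deleted_ranked[OF old_D] off that by (cases "k = h") auto
    show "(x, k') \<in> D'" if "(x, k) \<in> M'" "k' \<in> hospitals I"
        "strictly_prefers (res_pref I x) k' k" for x k k'
      using mem[OF that(1)] that better better_deleted D'(1) by blast
    show "(x, k') \<in> Rj'" if xk: "(x, k) \<in> M'" "(x, k) \<in> Rj'" "k' \<in> hospitals I"
        "(k, k') \<in> res_pref I x" "(k', k) \<in> res_pref I x" for x k k'
    proof -
      \<comment> \<open>A newly rejected resident is not in \<open>M'\<close> at \<open>h\<close>,
        so one who is held there was rejected before this proposal.\<close>
      have old: "(x, k) \<in> Rj" using new_Rj xk(1,2) by blast
      from mem[OF xk(1)] have "(x, k') \<in> Rj"
      proof
        assume "(x, k) \<in> M"
        then show ?thesis using tie_rejected old xk by blast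
      next
        assume "x = r \<and> k = h"
        \<comment> \<open>Rejected by \<open>h\<close> before, \<open>r\<close> now proposes to it
          again, so she has tried the whole tie; being unmatched, she was rejected each
          time.\<close>
        then have "(r, k') \<in> P" using tie[of k'] old xk Rj_sub by auto
        then show ?thesis using proposed_cases r_free \<open>x = r \<and> k = h\<close> by auto
      qed
      then show ?thesis using Rj'(1) by auto
    qed
  qed
qed

lemma card_insert_proposer: "card (insert r (ress_of M h)) = Suc (card (ress_of M h))"
  using finite_load r_free by (simp add: ress_of_iff)

text \<open>Steps (1) and (3). As \<open>h\<close> has room, nobody has deleted it, and the clauses
  on deletion are vacuous at \<open>h\<close>. The second premise supplies
  \<open>over_rejected\<close> once the new load exceeds the lower quota.\<close>

lemma accept:
  assumes "card (ress_of M h) < upper I h"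
    and "lower I h \<le> card (ress_of M h) \<Longrightarrow> \<forall>x\<in>insert r (ress_of M h). (x, h) \<in> Rj"
  shows "dp_invariant I (insert (r, h) M) (insert (r, h) P) Rj D"
proof -
  have ress: "ress_of (insert (r, h) M) h = insert r (ress_of M h)" by (auto simp: ress_of_def)
  have no_del: "(x, h) \<notin> D" for x using deleted_load assms(1) by force
  have load: "card (ress_of (insert (r, h) M) h) = Suc (card (ress_of M h))"
    unfolding ress by (rule card_insert_proposer)
  show ?thesis
  proof (rule update)
    show "(x, h) \<in> Rj"
      if "lower I h < card (ress_of (insert (r, h) M) h)" "(x, h) \<in> insert (r, h) M" for x
    proof -
      have "lower I h \<le> card (ress_of M h)" using that(1) load by simp
      moreover have "x \<in> insert r (ress_of M h)" using that(2) by (auto simp: ress_of_iff)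
      ultimately show ?thesis using assms(2) by blast
    qed
    show "Rj \<subseteq> insert (r, h) P" using Rj_sub by blast
  qed (use no_del D_sub load assms(1) in auto)
qed

text \<open>Steps (2) and (4), according to whether \<open>D'\<close> equals \<open>D\<close> or
  gains \<open>(w, h)\<close>. The load of \<open>h\<close> is unchanged; \<open>w = r\<close> is
  allowed and leaves the matching as it was.\<close>

lemma replace:
  assumes w: "w \<in> insert r (ress_of M h)"
    and low: "lower I h \<le> card (ress_of M h)"
    and D': "D' = D \<or> D' = insert (w, h) D"
    and over: "\<And>x. lower I h < card (ress_of M h) \<Longrightarrow> x \<in> insert r (ress_of M h) \<Longrightarrow> x \<noteq> w \<Longrightarrow> 
       (x, h) \<in> Rj"
    and del: "\<And>d. (d, h) \<in> D' \<Longrightarrow> card (ress_of M h) = upper I h"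
      "\<And>d x. (d, h) \<in> D' \<Longrightarrow> x \<in> insert r (ress_of M h) \<Longrightarrow> x \<noteq> w \<Longrightarrow>
         (x, h) \<in> Rj \<and> ranked_before I h x d"
  shows "dp_invariant I (insert (r, h) M - {(w, h)}) (insert (r, h) P) (insert (w, h) Rj) D'"
proof -
  have ress: "ress_of (insert (r, h) M - {(w, h)}) h = insert r (ress_of M h) - {w}"
    by (auto simp: ress_of_def)
  have card: "card (insert r (ress_of M h) - {w}) = card (ress_of M h)"
    using w card_insert_proposer finite_load by simp
  have load: "card (ress_of (insert (r, h) M - {(w, h)}) h) = card (ress_of M h)"
    unfolding ress by (rule card)
  have wP: "(w, h) \<in> insert (r, h) P" using w M_P by (auto simp: ress_of_iff)
  have mem: "x \<in> insert r (ress_of M h) \<and> x \<noteq> w" if "(x, h) \<in> insert (r, h) M - {(w, h)}" for x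
    using that by (auto simp: ress_of_iff)
  show ?thesis
  proof (rule update)
    show "insert (w, h) Rj \<subseteq> insert (r, h) P" using wP Rj_sub by blast
    show "D \<subseteq> D'" "D' \<subseteq> insert (w, h) Rj" using D' D_sub by auto
    show "k = h \<and> (x, h) \<notin> insert (r, h) M - {(w, h)}" if "(x, k) \<in> D'" "(x, k) \<notin> D" for x k
      using that D' by auto
    show "card (ress_of (insert (r, h) M - {(w, h)}) h) \<le> upper I h"
      unfolding load by (rule load_le[OF h])
    show "(x, h) \<in> insert (w, h) Rj"
      if "lower I h < card (ress_of (insert (r, h) M - {(w, h)}) h)"
        "(x, h) \<in> insert (r, h) M - {(w, h)}" for x
      using over[of x] mem[OF that(2)] that(1) unfolding load by blast
    show "card (ress_of (insert (r, h) M - {(w, h)}) h) = upper I h" if "(d, h) \<in> D'" for d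
      unfolding load by (rule del(1)[OF that])
    show "(x, h) \<in> insert (w, h) Rj \<and> ranked_before I h x d"
      if "(d, h) \<in> D'" "(x, h) \<in> insert (r, h) M - {(w, h)}" for d x
      using del(2)[OF that(1)] mem[OF that(2)] by blast
  qed (use low load in auto)
qed

lemma card_replace:
  assumes "w \<in> insert r (ress_of M h)"
  shows "card (insert (r, h) M - {(w, h)}) = card M"
proof -
  have "(w, h) \<in> insert (r, h) M" using assms by (auto simp: ress_of_iff)
  then show ?thesis using finite_sets(1) r_free by simp
qed

text \<open>The sum of the cardinalities measures progress: steps (1) and (3) add a matched pair,
  (2) a new rejection, (4) a new deletion, and the matching never shrinks.\<close>

lemma dp_respond:
  assumes s: "M = matching s" "P = proposed s" "Rj = rejected s" "D = deleted s"
    and s': "s' = respond I r h (s\<lparr>proposed := insert (r, h) (proposed s)\<rparr>)"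
  shows "dp_invariant I (matching s') (proposed s') (rejected s') (deleted s') \<and>
    card M + card Rj + card D < card (matching s') + card (rejected s') + card (deleted s')"
proof -
  define A where "A = insert r (ress_of M h)"
  define N where "N = {x \<in> A. (x, h) \<notin> Rj}"
  have A_sub: "A \<subseteq> residents I"
    using r ress_of_subset[OF M_sub] by (auto simp: A_def)
  have finA: "finite A" using finite_load by (simp add: A_def)
  have card_insert: "card (insert (r, h) M) = Suc (card M)"
    using finite_sets(1) r_free by simp
  have lu: "lower I h \<le> upper I h" using inst h by (simp add: hrt_instance_def)
  consider (below) "card (ress_of M h) < lower I h"
    | (first) "lower I h \<le> card (ress_of M h)" "N \<noteq> {}"
    | (room) "lower I h \<le> card (ress_of M h)" "N = {}" "card (ress_of M h) < upper I h"
    | (full) "lower I h \<le> card (ress_of M h)" "N = {}" "upper I h \<le> card (ress_of M h)"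
    by linarith
  then show ?thesis
  proof cases
    case below
    then have "s' = s\<lparr>proposed := insert (r, h) P, matching := insert (r, h) M\<rparr>"
      unfolding s' respond_def Let_def by (simp add: s)
    moreover have "dp_invariant I (insert (r, h) M) (insert (r, h) P) Rj D"
      using below lu by (intro accept) auto
    ultimately show ?thesis using card_insert by (simp add: s)
  next
    case first
    define w where "w = Max N"
    have s'_eq: "s' = s\<lparr>proposed := insert (r, h) P, matching := insert (r, h) M - {(w, h)},
        rejected := insert (w, h) Rj\<rparr>"
      using first unfolding s' respond_def Let_def by (simp add: s w_def N_def A_def)
    have "w \<in> N" unfolding w_def using first finA by (intro Max_in) (auto simp: N_def)
    then have w: "w \<in> insert r (ress_of M h)" "(w, h) \<notin> Rj" by (auto simp: N_def A_def)
    \<comment> \<open>If everyone held by \<open>h\<close> has been rejected, the proposer is the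
      only member of \<open>N\<close> and is turned away herself. This applies above the lower quota
      and after any deletion at \<open>h\<close>, so \<open>M\<close> then stays the same.\<close>
    have w_eq: "w = r" if "\<And>x. (x, h) \<in> M \<Longrightarrow> (x, h) \<in> Rj"
      using w that by (auto simp: ress_of_iff)
    have "dp_invariant I (insert (r, h) M - {(w, h)}) (insert (r, h) P) (insert (w, h) Rj) D"
    proof (rule replace[OF w(1) first(1)])
      show "(x, h) \<in> Rj"
        if "lower I h < card (ress_of M h)" "x \<in> insert r (ress_of M h)" "x \<noteq> w" for x
        using over_rejected that w_eq by (auto simp: ress_of_iff)
      show "card (ress_of M h) = upper I h" if "(d, h) \<in> D" for d
        by (rule deleted_load[OF that])
      show "(x, h) \<in> Rj \<and> ranked_before I h x d"
        if "(d, h) \<in> D" "x \<in> insert r (ress_of M h)" "x \<noteq> w" for d x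
        using w_eq deleted_rejected[OF that(1)] deleted_ranked[OF that(1)] that(2,3)
        by (auto simp: ress_of_iff)
    qed simp
    then show ?thesis using s'_eq card_replace[OF w(1)] finite_sets w(2) by (simp add: s)
  next
    case room
    then have "s' = s\<lparr>proposed := insert (r, h) P, matching := insert (r, h) M\<rparr>"
      unfolding s' respond_def Let_def by (simp add: s N_def A_def)
    moreover have "dp_invariant I (insert (r, h) M) (insert (r, h) P) Rj D"
      using room by (intro accept) (auto simp: N_def A_def)
    ultimately show ?thesis using card_insert by (simp add: s)
  next
    case full
    define w where "w = worst_for I h A"
    have s'_eq: "s' = s\<lparr>proposed := insert (r, h) P, matching := insert (r, h) M - {(w, h)},
        rejected := insert (w, h) Rj, deleted := insert (w, h) D\<rparr>"
      using full unfolding s' respond_def Let_def by (simp add: s w_def N_def A_def)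
    have A_ne: "A \<noteq> {}" by (simp add: A_def)
    have w: "w \<in> insert r (ress_of M h)"
      using worst_for_ranked(1)[OF inst h A_sub A_ne] by (simp add: w_def A_def)
    have worst: "ranked_before I h x w" if "x \<in> A" "x \<noteq> w" for x
      using worst_for_ranked(2)[OF inst h A_sub A_ne] that by (simp add: w_def)
    have w_new: "(w, h) \<notin> D" using w M_D h_listed by (auto simp: ress_of_iff)
    have "dp_invariant I (insert (r, h) M - {(w, h)}) (insert (r, h) P) (insert (w, h) Rj)
        (insert (w, h) D)"
    proof (rule replace[OF w full(1)])
      show "(x, h) \<in> Rj" if "x \<in> insert r (ress_of M h)" for x
        using full(2) that by (auto simp: N_def A_def)
      show "card (ress_of M h) = upper I h"
        using full(3) load_le[OF h] by simp
      show "(x, h) \<in> Rj \<and> ranked_before I h x d"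
        if d: "(d, h) \<in> insert (w, h) D" and x: "x \<in> insert r (ress_of M h)" "x \<noteq> w" for d x
      proof
        show "(x, h) \<in> Rj" using full(2) x by (auto simp: N_def A_def)
        show "ranked_before I h x d"
        proof (cases "d = w")
          case True
          then show ?thesis using worst x by (simp add: A_def)
        next
          case False
          then have dD: "(d, h) \<in> D" using d by simp
          show ?thesis
          proof (cases "x = r")
            case True
            \<comment> \<open>The proposer gets in by displacing \<open>w\<close>, who was held and
              hence ranked before the earlier deleted \<open>d\<close>.\<close>
            then have "(w, h) \<in> M" using w x by (auto simp: ress_of_iff)
            then have "ranked_before I h w d" by (rule deleted_ranked[OF dD])
            moreover have "ranked_before I h x w" using worst x by (simp add: A_def)
            ultimately show ?thesis using ranked_before_trans[OF inst h] by blast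
          next
            case False
            then show ?thesis using x deleted_ranked[OF dD] by (simp add: ress_of_iff)
          qed
        qed
      qed
    qed simp
    \<comment> \<open>As \<open>N\<close> is empty, \<open>(w, h)\<close> is in \<open>Rj\<close>
      already; the strict progress comes from \<open>D\<close>.\<close>
    moreover have "card Rj \<le> card (insert (w, h) Rj)" by (rule card_insert_le)
    ultimately show ?thesis using s'_eq card_replace[OF w] finite_sets w_new by (simp add: s)
  qed
qed

end

section \<open>The loop: choice of the target, termination, final state\<close>

lemma min_lower_in:
  assumes "finite C" "C \<noteq> {}"
  shows "min_lower I C \<in> C"
proof -
  define B where "B = {h \<in> C. \<forall>h'\<in>C. lower I h \<le> lower I h'}"
  have "Min (lower I ` C) \<in> lower I ` C" using assms by simp
  then obtain h where "h \<in> C" "lower I h = Min (lower I ` C)" by auto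
  then have "h \<in> B" using assms by (auto simp: B_def)
  then have "Min B \<in> B" using assms(1) by (intro Min_in) (auto simp: B_def)
  then show ?thesis by (simp add: min_lower_def B_def)
qed

definition dp_inv :: "hrt \<Rightarrow> dp_state \<Rightarrow> bool" where
  "dp_inv I s \<longleftrightarrow> dp_invariant I (matching s) (proposed s) (rejected s) (deleted s)"

definition dp_size :: "dp_state \<Rightarrow> nat" where
  "dp_size s = card (matching s) + card (rejected s) + card (deleted s)"

text \<open>\<open>better\<close> holds because the target is in the top tie of what remains of the
  list, \<open>tie\<close> because a hospital not yet proposed to is chosen whenever the tie
  contains one.\<close>

lemma dp_proposal_target:
  assumes inv: "dp_inv I s" and ne: "unmatched I s \<noteq> {}"
  defines "r \<equiv> Min (unmatched I s)"
  shows "dp_proposal I (matching s) (proposed s) (rejected s) (deleted s) r (proposal_target I s r)"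
proof -
  interpret dp_invariant I "matching s" "proposed s" "rejected s" "deleted s"
    using inv by (simp add: dp_inv_def)
  define T where "T = top_tie I s r"
  define F where "F = {h \<in> T. (r, h) \<notin> proposed s}"
  define t where "t = proposal_target I s r"
  have t_eq: "t = (if F \<noteq> {} then min_lower I F else min_lower I T)"
    unfolding t_def proposal_target_def Let_def F_def T_def ..
  have "r \<in> unmatched I s" unfolding r_def using ne by (intro Min_in) (auto simp: unmatched_def)
  then have r: "r \<in> residents I" "\<And>k. (r, k) \<notin> matching s"
    by (auto simp: unmatched_def hosps_of_def)
  have pref: "total_preorder_on (hospitals I) (res_pref I r)"
    using inst r(1) by (simp add: hrt_instance_def)
  have list_sub: "current_list I s r \<subseteq> hospitals I" by (auto simp: current_list_def)
  then have finT: "finite T"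
    by (intro finite_subset[of T "hospitals I"]) (auto simp: T_def top_tie_def)
  \<comment> \<open>A hospital with room has never been deleted, so the current list of
    \<open>r\<close> is nonempty.\<close>
  obtain k where "k \<in> hospitals I" "card (ress_of (matching s) k) < upper I k"
    using ex_undersubscribed[OF inst matching] by blast
  then have "k \<in> current_list I s r" using deleted_load by (force simp: current_list_def)
  then obtain b where "b \<in> current_list I s r" "\<And>x. x \<in> current_list I s r \<Longrightarrow> (b, x) \<in> res_pref I r"
    using total_preorder_on_worst[OF total_preorder_on_converse[OF pref] _ _ list_sub]
      finite_subset[OF list_sub] by (metis converse_iff empty_iff finite_hospitals)
  then have "T \<noteq> {}" by (auto simp: T_def top_tie_def)
  then have tT: "t \<in> T" and tF: "F \<noteq> {} \<Longrightarrow> t \<in> F"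
    using min_lower_in[of F I] min_lower_in[of T I] finT by (auto simp: t_eq F_def)
  have t_list: "t \<in> hospitals I" "(r, t) \<notin> deleted s"
    and t_top: "\<And>k. k \<in> hospitals I \<Longrightarrow> (r, k) \<notin> deleted s \<Longrightarrow> (t, k) \<in> res_pref I r"
    using tT by (auto simp: T_def top_tie_def current_list_def)
  have "dp_proposal I (matching s) (proposed s) (rejected s) (deleted s) r t"
  proof
    show "(r, k) \<in> deleted s" if "k \<in> hospitals I" "strictly_prefers (res_pref I r) k t" for k
      using t_top that by (auto simp: strictly_prefers_def)
    show "(r, k) \<in> proposed s" if k: "(r, t) \<in> proposed s" "k \<in> hospitals I"
        "(t, k) \<in> res_pref I r" "(k, t) \<in> res_pref I r" for k
    \<comment> \<open>A deleted hospital was proposed to before; one still listed lies in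
      \<open>T\<close>, and choosing \<open>t\<close> a second time means that \<open>F\<close> is
      empty.\<close>
    proof (cases "(r, k) \<in> deleted s")
      case True
      then show ?thesis using D_sub Rj_sub by blast
    next
      case False
      then have "k \<in> T"
        using k t_top total_preorder_onD(2)[OF pref k(4)] by (auto simp: T_def top_tie_def current_list_def)
      moreover have "F = {}" using tF k(1) by (auto simp: F_def)
      ultimately show ?thesis by (auto simp: F_def)
    qed
  qed (use r t_list in auto)
  then show ?thesis by (simp add: t_def)
qed

lemma dp_step_progress:
  assumes "dp_inv I s" "unmatched I s \<noteq> {}"
  shows "dp_inv I (dp_step I s)" "dp_size s < dp_size (dp_step I s)"
proof -
  interpret dp_proposal I "matching s" "proposed s" "rejected s" "deleted s"
    "Min (unmatched I s)" "proposal_target I s (Min (unmatched I s))"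
    by (rule dp_proposal_target[OF assms(1,2)])
  have "dp_step I s = respond I (Min (unmatched I s)) (proposal_target I s (Min (unmatched I s)))
      (s\<lparr>proposed := insert (Min (unmatched I s), proposal_target I s (Min (unmatched I s))) (proposed s)\<rparr>)"
    by (simp add: dp_step_def Let_def)
  from dp_respond[OF refl refl refl refl this]
  show "dp_inv I (dp_step I s)" "dp_size s < dp_size (dp_step I s)"
    by (simp_all add: dp_inv_def dp_size_def)
qed

lemma dp_size_le:
  assumes "dp_inv I s"
  shows "dp_size s \<le> 3 * (num_res I * num_hosp I)"
proof -
  interpret dp_invariant I "matching s" "proposed s" "rejected s" "deleted s"
    using assms by (simp add: dp_inv_def)
  have "card X \<le> num_res I * num_hosp I" if "X \<subseteq> residents I \<times> hospitals I" for X
    using card_mono[OF _ that] by (simp add: card_cartesian_product residents_def hospitals_def)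
  moreover have "rejected s \<subseteq> residents I \<times> hospitals I" using Rj_sub P_sub by (rule subset_trans)
  moreover from D_sub this have "deleted s \<subseteq> residents I \<times> hospitals I" by (rule subset_trans)
  ultimately have "card (matching s) \<le> num_res I * num_hosp I"
    "card (rejected s) \<le> num_res I * num_hosp I" "card (deleted s) \<le> num_res I * num_hosp I"
    using M_sub by simp_all
  then show ?thesis by (simp add: dp_size_def)
qed

lemma double_proposal_output:
  assumes "hrt_instance I"
  shows "\<exists>P Rj D. dp_invariant I (double_proposal I) P Rj D"
    and "\<And>r. r \<in> residents I \<Longrightarrow> \<exists>h. (r, h) \<in> double_proposal I"
proof -
  define fin where "fin = while (\<lambda>s. unmatched I s \<noteq> {}) (dp_step I) dp_init"
  have "dp_inv I fin \<and> unmatched I fin = {}"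
    unfolding fin_def
  proof (rule while_rule[where P = "dp_inv I"
        and r = "measure (\<lambda>s. 3 * (num_res I * num_hosp I) - dp_size s)"])
    show "dp_inv I dp_init"
      using assms unfolding dp_inv_def dp_init_def by unfold_locales (auto simp: ress_of_def)
    show "dp_inv I (dp_step I s)" if "dp_inv I s" "unmatched I s \<noteq> {}" for s
      by (rule dp_step_progress(1)[OF that])
    show "(dp_step I s, s) \<in> measure (\<lambda>s. 3 * (num_res I * num_hosp I) - dp_size s)"
      if "dp_inv I s" "unmatched I s \<noteq> {}" for s
      \<comment> \<open>Bounding the size of the next state makes the truncated subtraction decrease
        strictly.\<close>
      using dp_step_progress[OF that] dp_size_le[of I "dp_step I s"] by simp
  qed auto
  then have "dp_invariant I (double_proposal I) (proposed fin) (rejected fin) (deleted fin)"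
    and unm: "unmatched I fin = {}"
    by (simp_all add: dp_inv_def double_proposal_def fin_def)
  then show "\<exists>P Rj D. dp_invariant I (double_proposal I) P Rj D" by blast
  show "\<exists>h. (r, h) \<in> double_proposal I" if "r \<in> residents I" for r
    using that unm by (auto simp: unmatched_def hosps_of_def double_proposal_def fin_def)
qed

section \<open>Stability and structure of the output\<close>

lemma double_proposal_stable:
  assumes "hrt_instance I"
  shows "stable_matching I (double_proposal I)"
proof -
  obtain P Rj D where "dp_invariant I (double_proposal I) P Rj D"
    using double_proposal_output(1)[OF assms(1)] by blast
  then interpret dp_invariant I "double_proposal I" P Rj D .
  have "\<not> blocks I (double_proposal I) r h" if rh: "r \<in> residents I" "h \<in> hospitals I" for r h
  proof
    assume blk: "blocks I (double_proposal I) r h"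
    then obtain h' where "(r, h') \<in> double_proposal I" "strictly_prefers (res_pref I r) h h'"
      using double_proposal_output(2)[OF assms rh(1)] by (auto simp: blocks_def hosps_of_def)
    \<comment> \<open>After a deletion \<open>h\<close> is full of residents ranked before
      \<open>r\<close>, so neither alternative of the second blocking condition can hold.\<close>
    then have D: "(r, h) \<in> D" using better_deleted rh(2) by blast
    then obtain r' where "(r', h) \<in> double_proposal I" "strictly_prefers (hosp_pref I h) r r'"
      using blk deleted_load by (auto simp: blocks_def ress_of_def)
    then show False using deleted_ranked[OF D] by (auto simp: ranked_before_def strictly_prefers_def)
  qed
  then show ?thesis using matching by (simp add: stable_matching_def)
qed

text \<open>The pair \<open>(r, h')\<close> must have been deleted. The ranking includes the index,
  on which the analysis of the tight instances relies.\<close>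

lemma double_proposal_better_full:
  assumes "hrt_instance I" "(r, h) \<in> double_proposal I" "h' \<in> hospitals I"
    "strictly_prefers (res_pref I r) h' h"
  shows "card (ress_of (double_proposal I) h') = upper I h'"
    and "\<And>x. (x, h') \<in> double_proposal I \<Longrightarrow> ranked_before I h' x r"
proof -
  obtain P Rj D where "dp_invariant I (double_proposal I) P Rj D"
    using double_proposal_output(1)[OF assms(1)] by blast
  then interpret dp_invariant I "double_proposal I" P Rj D .
  have "(r, h') \<in> D" using better_deleted assms by blast
  then show "card (ress_of (double_proposal I) h') = upper I h'"
    and "\<And>x. (x, h') \<in> double_proposal I \<Longrightarrow> ranked_before I h' x r"
    using deleted_load deleted_ranked by blast+
qed

text \<open>The residents of a hospital above its lower quota have been rejected by it, hence have
  proposed to it a second time, which requires proposals to the whole tie before.\<close>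

lemma double_proposal_tie:
  assumes "hrt_instance I" "(r, h) \<in> double_proposal I" "h' \<in> hospitals I"
    "(h, h') \<in> res_pref I r" "(h', h) \<in> res_pref I r"
    "lower I h < card (ress_of (double_proposal I) h)"
  shows "lower I h' \<le> card (ress_of (double_proposal I) h')"
proof -
  obtain P Rj D where "dp_invariant I (double_proposal I) P Rj D"
    using double_proposal_output(1)[OF assms(1)] by blast
  then interpret dp_invariant I "double_proposal I" P Rj D .
  show ?thesis using rejected_load tie_rejected over_rejected assms by blast
qed

section \<open>The upper bound\<close>

lemma uniform_score:
  assumes "uniform_instance l u I" "1 \<le> l"
  shows "score I M = (\<Sum>h\<in>hospitals I. real (min (card (ress_of M h)) l)) / real l"
proof -
  have "hosp_score I M h = real (min (card (ress_of M h)) l) / real l" if "h \<in> hospitals I" for h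
    using assms that by (auto simp: hosp_score_def uniform_instance_def min_def field_simps)
  then show ?thesis by (simp add: score_def sum_divide_distrib)
qed

text \<open>Pure counting; \<open>a\<close> and \<open>b\<close> stand for \<open>l\<close> times
  the two scores. Beyond equal totals, stability and the run of the algorithm enter only through
  \<open>moves\<close>.\<close>

lemma truncated_loads_bound:
  fixes m n :: "'a \<Rightarrow> nat"
  assumes fin: "finite H" and lu: "l \<le> u"
    and m: "\<And>h. h \<in> H \<Longrightarrow> m h \<le> u" and n: "\<And>h. h \<in> H \<Longrightarrow> n h \<le> u"
    and total: "sum m H = sum n H"
    and L: "L = {h \<in> H. m h < l}" and Q: "Q = {h \<in> H. l < m h \<and> n h < u}"
    and moves: "sum n L \<le> sum m (H - Q)"
  defines "a \<equiv> (\<Sum>h\<in>H. real (min (m h) l))" and "b \<equiv> (\<Sum>h\<in>H. real (min (n h) l))"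
  shows "real l * (2 * real u - real l) * (b - a) \<le> real u * (real u - real l) * a"
proof -
  define C where "C = H - Q - L"
  have fins: "finite L" "finite Q" "finite C" using fin by (auto simp: L Q C_def)
  have split: "H = L \<union> (Q \<union> C)" "L \<inter> (Q \<union> C) = {}" "Q \<inter> C = {}" by (auto simp: L Q C_def)
  have excess: "b - a \<le> (real u - real l) * card Q"
  proof -
    \<comment> \<open>The totals agree, so they may be subtracted; \<open>min x l - x\<close> is
      minus the excess of \<open>x\<close> over \<open>l\<close>. Outside \<open>Q\<close> either
      \<open>m h\<close> has no excess or \<open>n h = u\<close> has the largest possible
      one.\<close>
    have "b - a = (\<Sum>h\<in>H. real (min (n h) l) - real (n h) - (real (min (m h) l) - real (m h)))"
      using total unfolding a_def b_def sum_subtractf of_nat_sum[symmetric] by simp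
    also have "\<dots> \<le> (\<Sum>h\<in>H. if h \<in> Q then real u - real l else 0)"
    proof (rule sum_mono)
      fix h assume h: "h \<in> H"
      then show "real (min (n h) l) - real (n h) - (real (min (m h) l) - real (m h))
          \<le> (if h \<in> Q then real u - real l else 0)"
        using m[OF h] n[OF h] lu by (auto simp: Q min_def)
    qed
    also have "\<dots> = (real u - real l) * card Q"
      using fin by (simp add: sum.If_cases Q Int_def)
    finally show ?thesis .
  qed
  have gain: "b - a \<le> real u * card C"
  proof -
    \<comment> \<open>Only hospitals in \<open>L\<close> can gain. After \<open>moves\<close> is
      applied, the load \<open>m\<close> on \<open>L\<close> cancels and only that on
      \<open>C\<close> is left.\<close>
    have "b - a = (\<Sum>h\<in>H. real (min (n h) l) - real (min (m h) l))"
      by (simp add: a_def b_def sum_subtractf)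
    also have "\<dots> \<le> (\<Sum>h\<in>H. if h \<in> L then real (n h) - real (m h) else 0)"
      by (rule sum_mono) (auto simp: L min_def)
    also have "\<dots> = (\<Sum>h\<in>L. real (n h) - real (m h))"
      using fin by (simp add: sum.If_cases L Int_def)
    also have "\<dots> = real (sum n L) - real (sum m L)" by (simp add: sum_subtractf)
    also have "\<dots> \<le> real (sum m (H - Q)) - real (sum m L)"
      using moves by (simp del: of_nat_sum)
    also have "sum m (H - Q) = sum m L + sum m C"
    proof -
      have "H - Q = L \<union> C" "L \<inter> C = {}" by (auto simp: L Q C_def)
      then show ?thesis using fins by (simp add: sum.union_disjoint)
    qed
    also have "real (sum m L + sum m C) - real (sum m L) = real (sum m C)" by simp
    also have "sum m C \<le> card C * u"
      using sum_bounded_above[of C m u] m by (auto simp: C_def)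
    finally show ?thesis by (simp add: mult.commute)
  qed
  have low: "real l * (real (card Q) + real (card C)) \<le> a"
  proof -
    have "real l * (real (card Q) + real (card C)) = (\<Sum>h\<in>Q \<union> C. real (min (m h) l))"
    proof -
      have "(\<Sum>h\<in>Q \<union> C. real (min (m h) l)) = (\<Sum>h\<in>Q \<union> C. real l)"
        by (rule sum.cong) (auto simp: L Q C_def)
      also have "\<dots> = real (card (Q \<union> C)) * real l" by simp
      also have "card (Q \<union> C) = card Q + card C" using fins split by (simp add: card_Un_disjoint)
      finally show ?thesis by (simp add: mult.commute)
    qed
    also have "\<dots> \<le> a" unfolding a_def by (rule sum_mono2) (use fin split in auto)
    finally show ?thesis .
  qed
  \<comment> \<open>The weights \<open>u\<close> and \<open>u - l\<close> give the sizes of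
    \<open>Q\<close> and \<open>C\<close> the same coefficient \<open>u * (u - l)\<close>, so that
    \<open>low\<close> applies to their sum.\<close>
  have "real u * (b - a) \<le> real u * ((real u - real l) * card Q)"
    using excess by (intro mult_left_mono) auto
  moreover have "(real u - real l) * (b - a) \<le> (real u - real l) * (real u * card C)"
    using gain lu by (intro mult_left_mono) auto
  ultimately have "(2 * real u - real l) * (b - a) \<le> 
      real u * (real u - real l) * (real (card Q) + real (card C))"
    by (simp add: algebra_simps)
  then have "real l * ((2 * real u - real l) * (b - a)) \<le>
      real l * (real u * (real u - real l) * (real (card Q) + real (card C)))"
    by (rule mult_left_mono) simp
  also have "\<dots> = real u * (real u - real l) * (real l * (real (card Q) + real (card C)))"
    by (simp add: algebra_simps)
  also have "\<dots> \<le> real u * (real u - real l) * a"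
    using low lu by (intro mult_left_mono) auto
  finally show ?thesis by (simp add: mult.assoc)
qed

lemma uniform_score_bound:
  assumes I: "uniform_instance l u I" and l: "1 \<le> l" "l \<le> u"
    and N: "stable_matching I N"
  shows "real l * (2 * real u - real l) * (score I N - ALG I) \<le> real u * (real u - real l) * ALG I"
proof -
  define M where "M = double_proposal I"
  define m n where "m h = card (ress_of M h)" and "n h = card (ress_of N h)" for h
  define H where "H = hospitals I"
  define L Q where "L = {h \<in> H. m h < l}" and "Q = {h \<in> H. l < m h \<and> n h < u}"
  have inst: "hrt_instance I" and quotas: "\<And>h. h \<in> H \<Longrightarrow> lower I h = l \<and> upper I h = u"
    using I by (auto simp: uniform_instance_def H_def)
  have M: "stable_matching I M" unfolding M_def by (rule double_proposal_stable[OF inst])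
  then have mM: "is_matching I M" and mN: "is_matching I N"
    using N by (auto simp: stable_matching_def)
  have complete: "\<exists>h. (r, h) \<in> X" if "stable_matching I X" "r \<in> residents I" for X r
    using stable_matching_complete[OF inst that] by blast
  have stays: "h \<notin> Q" if rk: "(r, k) \<in> N" "k \<in> L" and rh: "(r, h) \<in> M" for r h k
  proof
    assume hQ: "h \<in> Q"
    have r: "r \<in> residents I" and h: "h \<in> H" and k: "k \<in> H"
      using rk rh mM mN by (auto simp: is_matching_def H_def)
    have pref: "total_preorder_on H (res_pref I r)"
      using inst r by (simp add: hrt_instance_def H_def)
    \<comment> \<open>Case 1 would make \<open>k\<close> full in the output, case 2 lets
      \<open>(r, h)\<close> block \<open>N\<close>, and in case 3 the rejections throughout the tie
      force \<open>k\<close> up to its lower quota.\<close>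
    consider "strictly_prefers (res_pref I r) k h" | "strictly_prefers (res_pref I r) h k"
      | "(h, k) \<in> res_pref I r" "(k, h) \<in> res_pref I r"
      using total_preorder_onD(3)[OF pref h k] by (auto simp: strictly_prefers_def)
    then show False
    proof cases
      case 1
      then have "card (ress_of M k) = upper I k"
        using double_proposal_better_full(1)[OF inst] rh k by (simp add: M_def H_def)
      then show False using rk(2) quotas[OF k] l(2) by (simp add: L_def m_def)
    next
      case 2
      moreover have "card (ress_of N h) < upper I h" using hQ quotas[OF h] by (simp add: Q_def n_def)
      ultimately have "blocks I N r h" using rk(1) by (auto simp: blocks_def hosps_of_def)
      then show False using N r h by (simp add: stable_matching_def H_def)
    next
      case 3
      have "lower I h < card (ress_of M h)" using hQ quotas[OF h] by (simp add: Q_def m_def)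
      then have "lower I k \<le> card (ress_of M k)"
        using double_proposal_tie[OF inst] rh k 3 by (simp add: M_def H_def)
      then show False using rk(2) quotas[OF k] by (simp add: L_def m_def)
    qed
  qed
  have "(\<Union>h\<in>L. ress_of N h) \<subseteq> (\<Union>h\<in>H - Q. ress_of M h)"
  proof
    fix r assume "r \<in> (\<Union>h\<in>L. ress_of N h)"
    then obtain k where k: "k \<in> L" "(r, k) \<in> N" by (auto simp: ress_of_def)
    then have "r \<in> residents I" using mN by (auto simp: is_matching_def)
    then obtain h where h: "(r, h) \<in> M" using complete[OF M] by blast
    then have "h \<in> H" using mM by (auto simp: is_matching_def H_def)
    then show "r \<in> (\<Union>h\<in>H - Q. ress_of M h)"
      using stays[OF k(2,1) h] h by (auto simp: ress_of_def)
  qed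
  moreover have "finite (\<Union>h\<in>H - Q. ress_of M h)"
    using mM by (auto simp: H_def is_matching_def intro: finite_ress_of)
  ultimately have moves: "sum n L \<le> sum m (H - Q)"
    using sum_loads_eq_card[OF mN, of L] sum_loads_eq_card[OF mM, of "H - Q"]
    by (simp add: n_def m_def L_def H_def card_mono)
  have total: "sum m H = sum n H"
    using sum_loads_complete[OF mM complete[OF M]] sum_loads_complete[OF mN complete[OF N]]
    by (simp add: m_def n_def H_def)
  have loads: "m h \<le> u" "n h \<le> u" if "h \<in> H" for h
    using mM mN that quotas[OF that] by (auto simp: is_matching_def m_def n_def H_def)
  have "finite H" by (simp add: H_def)
  \<comment> \<open>The truncated sums are \<open>l\<close> times the scores; the surplus factor
    \<open>l\<close> cancels at the end.\<close>
  from truncated_loads_bound[OF this l(2) loads total L_def Q_def moves]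
  have "real l * (2 * real u - real l) * (real l * score I N - real l * score I M)
      \<le> real u * (real u - real l) * (real l * score I M)"
    using l(1) by (simp add: uniform_score[OF I l(1)] m_def n_def H_def)
  then have "real l * (real l * (2 * real u - real l) * (score I N - score I M))
      \<le> real l * (real u * (real u - real l) * score I M)"
    by (simp add: algebra_simps)
  then show ?thesis using l(1) by (simp add: ALG_def M_def)
qed

text \<open>Guards the ratio against division by zero: resident 1 exists and is matched, so her
  hospital has a positive score.\<close>

lemma ALG_pos:
  assumes I: "uniform_instance l u I" and l: "1 \<le> l"
  shows "0 < ALG I"
proof -
  have inst: "hrt_instance I" using I by (simp add: uniform_instance_def)
  have M: "is_matching I (double_proposal I)"
    using double_proposal_stable[OF inst] by (simp add: stable_matching_def)
  have "1 \<in> residents I" using inst by (simp add: hrt_instance_def residents_def)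
  then obtain h where h: "(1, h) \<in> double_proposal I" using double_proposal_output(2)[OF inst] by blast
  then have "h \<in> hospitals I" and "finite (ress_of (double_proposal I) h)"
    using M finite_ress_of by (auto simp: is_matching_def)
  moreover have "ress_of (double_proposal I) h \<noteq> {}" using h by (auto simp: ress_of_def)
  ultimately have "0 < (\<Sum>h\<in>hospitals I. real (min (card (ress_of (double_proposal I) h)) l))"
    using l by (intro sum_pos2[of _ h]) (auto simp: card_gt_0_iff)
  then show ?thesis using l by (simp add: ALG_def uniform_score[OF I l])
qed

text \<open>\<open>Max\<close> in \<open>OPT\<close> needs a finite nonempty set; nonemptiness comes
  later from the output of the algorithm.\<close>

lemma finite_stable_matchings: "finite {M. stable_matching I M}"
  by (rule finite_subset[of _ "Pow (residents I \<times> hospitals I)"])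
    (auto simp: stable_matching_def is_matching_def)

lemma score_le_OPT: "stable_matching I M \<Longrightarrow> score I M \<le> OPT I"
  unfolding OPT_def using finite_stable_matchings[of I] by (intro Max_ge) auto

lemma OPT_attained:
  assumes "hrt_instance I"
  obtains M where "stable_matching I M" "OPT I = score I M"
proof -
  have "OPT I \<in> {score I M | M. stable_matching I M}"
    unfolding OPT_def using finite_stable_matchings[of I] double_proposal_stable[OF assms]
    by (intro Max_in) auto
  then show thesis using that by blast
qed

text \<open>The right-hand side is the claimed factor for \<theta> equal to \<open>u / l\<close>,
  with 1 split off.\<close>

lemma ratio_bound:
  assumes I: "uniform_instance l u I" and l: "1 \<le> l" "l \<le> u"
  shows "OPT I / ALG I \<le> 1 + real u * (real u - real l) / (real l * (2 * real u - real l))"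
proof -
  have "hrt_instance I" using I by (simp add: uniform_instance_def)
  then obtain N where N: "stable_matching I N" "OPT I = score I N" by (rule OPT_attained)
  have pos: "0 < ALG I" by (rule ALG_pos[OF I l(1)])
  have den: "0 < real l * (2 * real u - real l)" using l by simp
  have "OPT I - ALG I \<le> real u * (real u - real l) / (real l * (2 * real u - real l)) * ALG I"
    using uniform_score_bound[OF I l N(1)] den by (simp add: N(2) pos_le_divide_eq mult.commute)
  then show ?thesis using pos by (simp add: pos_divide_le_eq algebra_simps)
qed

section \<open>A tight family of instances\<close>

text \<open>With \<open>p = u - l\<close>, the hospitals form three tiers: \<open>1..p\<close> (filled by both matchings),
  \<open>p+1..p+u\<close> (filled by the algorithm, reduced to load \<open>l\<close> in the better matching) and the
  rest (empty in the output, one resident each in the better matching). One further hospital,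
  always empty, keeps the number of residents below the total upper quota when \<open>u = l\<close>.\<close>

definition tight_rank :: "nat \<Rightarrow> nat \<Rightarrow> nat \<Rightarrow> nat \<Rightarrow> nat" where
  "tight_rank p u r h =
     (if h \<le> p then 0 else if (h \<le> p + u) = (p * u < r) then 1 else 2)"

text \<open>The residents are just enough to fill the first two tiers. All rank the first tier on
  top; next come the third tier for residents up to \<open>p * u\<close> and the second tier for the
  others. Indifferent hospitals leave every decision to the indices.\<close>

definition tight_instance :: "nat \<Rightarrow> nat \<Rightarrow> hrt" where
  "tight_instance l u =
     (let p = u - l; m = p + u + p * u + 1; n = (p + u) * u in
      \<lparr>num_res = n, num_hosp = m,
       res_pref = \<lambda>r. {(a, b) \<in> {1..m} \<times> {1..m}. tight_rank p u r a \<le> tight_rank p u r b},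
       hosp_pref = \<lambda>h. {1..n} \<times> {1..n},
       lower = \<lambda>h. l, upper = \<lambda>h. u\<rparr>)"

text \<open>Consecutive blocks of residents: the first \<open>p * u\<close> go singly to the third
  tier, the next \<open>p * u\<close> fill the first tier, and the last \<open>u * l\<close> give
  load \<open>l\<close> to the second. Indices start at 1, hence the shift before \<open>div\<close>
  and the \<open>Suc\<close> after it.\<close>

definition tight_hosp :: "nat \<Rightarrow> nat \<Rightarrow> nat \<Rightarrow> nat" where
  "tight_hosp l u r =
     (let p = u - l in
      if r \<le> p * u then p + u + r
      else if r \<le> 2 * (p * u) then Suc ((r - p * u - 1) div u)
      else p + Suc ((r - 2 * (p * u) - 1) div l))"

definition tight_matching :: "nat \<Rightarrow> nat \<Rightarrow> assignment" where
  "tight_matching l u = {(r, tight_hosp l u r) | r. r \<in> residents (tight_instance l u)}"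

text \<open>The set is the interval from \<open>c + k * d + 1\<close> to
  \<open>c + k * d + d\<close>; the second assumption keeps it below \<open>b\<close>.\<close>

lemma card_div_eq:
  fixes c d k b :: nat
  assumes "0 < d" "c + Suc k * d \<le> b"
  shows "card {r. c < r \<and> r \<le> b \<and> (r - c - 1) div d = k} = d"
proof -
  have "{r. c < r \<and> r \<le> b \<and> (r - c - 1) div d = k} = {c + k * d + 1..c + k * d + d}"
  proof (intro set_eqI iffI)
    fix r assume r: "r \<in> {r. c < r \<and> r \<le> b \<and> (r - c - 1) div d = k}"
    have "k * d \<le> r - c - 1"
      using r div_times_less_eq_dividend[of "r - c - 1" d] by blast
    moreover have "r - c - 1 < k * d + d"
      using r dividend_less_div_times[OF assms(1), of "r - c - 1"] by (auto simp: add.commute)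
    moreover have "c < r" using r by blast
    ultimately show "r \<in> {c + k * d + 1..c + k * d + d}" by auto
  next
    fix r assume r: "r \<in> {c + k * d + 1..c + k * d + d}"
    then have "(r - c - 1) div d = k"
      by (intro div_nat_eqI) (auto simp: mult.commute)
    then show "r \<in> {r. c < r \<and> r \<le> b \<and> (r - c - 1) div d = k}" using r assms(2) by auto
  qed
  then show ?thesis by simp
qed

context
  fixes l u p :: nat and I :: hrt
  assumes l: "1 \<le> l" and lu: "l \<le> u"
  defines "p \<equiv> u - l" and "I \<equiv> tight_instance l u"
begin

lemma tight_simps:
  "residents I = {1..(p + u) * u}" "hospitals I = {1..p + u + p * u + 1}"
  "num_res I = (p + u) * u" "num_hosp I = p + u + p * u + 1"
  "lower I h = l" "upper I h = u"
  "hosp_pref I h = {1..(p + u) * u} \<times> {1..(p + u) * u}"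
  by (simp_all add: I_def tight_instance_def residents_def hospitals_def Let_def p_def)

lemma tight_prefers:
  "strictly_prefers (res_pref I r) a b \<longleftrightarrow>
     a \<in> hospitals I \<and> b \<in> hospitals I \<and> tight_rank p u r a < tight_rank p u r b"
  unfolding strictly_prefers_def tight_simps
  by (auto simp: I_def tight_instance_def Let_def p_def)

text \<open>The lengths of the blocks in \<open>tight_hosp\<close>, obtained from
  \<open>u = p + l\<close>.\<close>

lemma num_split: "(p + u) * u = 2 * (p * u) + u * l"
proof -
  have "u = p + l" using lu by (simp add: p_def)
  then have "u * u = p * u + l * u" by (metis add_mult_distrib)
  then show ?thesis by (simp add: algebra_simps)
qed

lemma tight_uniform: "uniform_instance l u I"
proof -
  have u: "1 \<le> u" using l lu by simp
  have "u \<le> (p + u) * u" using u by simp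
  moreover have "(p + u) * u < (p + u + p * u + 1) * u"
    using u by (intro mult_strict_right_mono) auto
  moreover have "total_preorder_on (hospitals I) (res_pref I r)" for r
    unfolding tight_simps
    by (auto simp: total_preorder_on_def preorder_on_def refl_on_def total_on_def trans_def
        I_def tight_instance_def Let_def p_def)
  moreover have "total_preorder_on (residents I) (hosp_pref I h)" for h
    unfolding tight_simps
    by (auto simp: total_preorder_on_def preorder_on_def refl_on_def total_on_def trans_def)
  ultimately show ?thesis
    using u lu unfolding uniform_instance_def hrt_instance_def
    by (simp add: tight_simps mult.commute)
qed

lemma tight_hrt_instance: "hrt_instance I"
  using tight_uniform by (simp add: uniform_instance_def)

section \<open>The better stable matching\<close>

lemma tight_matching_iff:
  "(r, h) \<in> tight_matching l u \<longleftrightarrow> r \<in> residents I \<and> h = tight_hosp l u r"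
  by (auto simp: tight_matching_def I_def)

lemma ress_of_tight: "ress_of (tight_matching l u) h = {r \<in> residents I. tight_hosp l u r = h}"
  by (auto simp: ress_of_def tight_matching_iff)

lemma tight_hosp_cases:
  assumes "r \<in> residents I"
  obtains (single) "r \<le> p * u" "tight_hosp l u r = p + u + r"
    | (shared) "p * u < r" "r \<le> 2 * (p * u)" "tight_hosp l u r = Suc ((r - p * u - 1) div u)"
        "tight_hosp l u r \<le> p"
    | (partial) "2 * (p * u) < r" "tight_hosp l u r = p + Suc ((r - 2 * (p * u) - 1) div l)"
        "tight_hosp l u r \<le> p + u"
proof -
  consider "r \<le> p * u" | "p * u < r" "r \<le> 2 * (p * u)" | "2 * (p * u) < r" by linarith
  then show thesis
  proof cases
    case 1
    then show thesis using single by (simp add: tight_hosp_def p_def Let_def)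
  next
    case 2
    then have "(r - p * u - 1) div u < p"
      using lu l by (intro less_mult_imp_div_less) auto
    then show thesis using 2 shared by (simp add: tight_hosp_def p_def Let_def)
  next
    case 3
    then have "(r - 2 * (p * u) - 1) div l < u"
      using assms num_split by (intro less_mult_imp_div_less) (auto simp: tight_simps)
    then show thesis using 3 partial by (simp add: tight_hosp_def p_def Let_def)
  qed
qed

lemma tight_loads:
  "1 \<le> h \<Longrightarrow> h \<le> p \<Longrightarrow> card (ress_of (tight_matching l u) h) = u"
  "p < h \<Longrightarrow> h \<le> p + u \<Longrightarrow> card (ress_of (tight_matching l u) h) = l"
  "p + u < h \<Longrightarrow> h \<le> p + u + p * u \<Longrightarrow> card (ress_of (tight_matching l u) h) = 1"
  "p + u + p * u < h \<Longrightarrow> card (ress_of (tight_matching l u) h) = 0"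
proof -
  let ?N = "ress_of (tight_matching l u) h"
  have u: "0 < u" using l lu by simp
  show "card ?N = u" if h: "1 \<le> h" "h \<le> p"
  proof -
    have "?N = {r. p * u < r \<and> r \<le> 2 * (p * u) \<and> (r - p * u - 1) div u = h - 1}"
    proof (intro set_eqI iffI)
      fix r assume "r \<in> ?N"
      then have r: "r \<in> residents I" "tight_hosp l u r = h" by (auto simp: ress_of_tight)
      from r(1) show "r \<in> {r. p * u < r \<and> r \<le> 2 * (p * u) \<and> (r - p * u - 1) div u = h - 1}"
        by (cases rule: tight_hosp_cases) (use r h in \<open>auto simp: tight_simps\<close>)
    next
      fix r assume "r \<in> {r. p * u < r \<and> r \<le> 2 * (p * u) \<and> (r - p * u - 1) div u = h - 1}"
      then show "r \<in> ?N" using h num_split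
        by (auto simp: ress_of_tight tight_simps tight_hosp_def Let_def p_def[symmetric])
    qed
    moreover have "p * u + Suc (h - 1) * u \<le> 2 * (p * u)" using h by simp
    ultimately show ?thesis using card_div_eq[OF u] by simp
  qed
  show "card ?N = l" if h: "p < h" "h \<le> p + u"
  proof -
    have "?N = {r. 2 * (p * u) < r \<and> r \<le> (p + u) * u \<and> (r - 2 * (p * u) - 1) div l = h - p - 1}"
    proof (intro set_eqI iffI)
      fix r assume "r \<in> ?N"
      then have r: "r \<in> residents I" "tight_hosp l u r = h" by (auto simp: ress_of_tight)
      from r(1) show "r \<in> {r. 2 * (p * u) < r \<and> r \<le> (p + u) * u \<and> (r - 2 * (p * u) - 1) div l = h - p - 1}"
        by (cases rule: tight_hosp_cases) (use r h in \<open>auto simp: tight_simps\<close>)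
    next
      fix r assume "r \<in> {r. 2 * (p * u) < r \<and> r \<le> (p + u) * u \<and> (r - 2 * (p * u) - 1) div l = h - p - 1}"
      then show "r \<in> ?N" using h
        by (auto simp: ress_of_tight tight_simps tight_hosp_def Let_def p_def[symmetric])
    qed
    moreover have "2 * (p * u) + Suc (h - p - 1) * l \<le> (p + u) * u"
    proof -
      have "Suc (h - p - 1) * l \<le> u * l" using h by (intro mult_right_mono) auto
      then show ?thesis unfolding num_split by simp
    qed
    moreover have "0 < l" using l by simp
    ultimately show ?thesis using card_div_eq by simp
  qed
  have high: "?N = {r \<in> {1..p * u}. p + u + r = h}" if h: "p + u < h"
  proof (intro set_eqI iffI)
    fix r assume "r \<in> ?N"
    then have r: "r \<in> residents I" "tight_hosp l u r = h" by (auto simp: ress_of_tight)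
    from r(1) show "r \<in> {r \<in> {1..p * u}. p + u + r = h}"
      by (cases rule: tight_hosp_cases) (use r h in \<open>auto simp: tight_simps\<close>)
  next
    fix r assume "r \<in> {r \<in> {1..p * u}. p + u + r = h}"
    then show "r \<in> ?N" using num_split
      by (auto simp: ress_of_tight tight_simps tight_hosp_def Let_def p_def[symmetric])
  qed
  show "card ?N = 1" if h: "p + u < h" "h \<le> p + u + p * u"
  proof -
    have "?N = {h - (p + u)}" unfolding high[OF h(1)] using h by auto
    then show ?thesis by simp
  qed
  show "card ?N = 0" if h: "p + u + p * u < h"
  proof -
    have "?N = {}" using high h by auto
    then show ?thesis by simp
  qed
qed

text \<open>Everyone gets a hospital of rank at most 1, so a blocking hospital would have rank 0.
  Those are the hospitals of the first tier, which are full and indifferent.\<close>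

lemma tight_matching_stable: "stable_matching I (tight_matching l u)"
proof -
  have hosp: "tight_hosp l u r \<in> hospitals I" "tight_rank p u r (tight_hosp l u r) \<le> 1"
    if "r \<in> residents I" for r
    using that
    by (cases rule: tight_hosp_cases; use that in \<open>auto simp: tight_simps tight_rank_def\<close>)+
  have load: "card (ress_of (tight_matching l u) h) \<le> u" if "1 \<le> h" for h
    using tight_loads[of h] that l lu
    by (cases "h \<le> p"; cases "h \<le> p + u"; cases "h \<le> p + u + p * u") auto
  have "is_matching I (tight_matching l u)"
    using hosp(1) load by (auto simp: is_matching_iff tight_matching_iff tight_simps(2,6))
  moreover have "\<not> blocks I (tight_matching l u) r h"
    if r: "r \<in> residents I" and h: "h \<in> hospitals I" for r h
  proof
    assume blk: "blocks I (tight_matching l u) r h"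
    have "hosps_of (tight_matching l u) r = {tight_hosp l u r}"
      using r by (auto simp: hosps_of_def tight_matching_iff)
    then have "tight_rank p u r h < tight_rank p u r (tight_hosp l u r)"
      using blk by (auto simp: blocks_def tight_prefers)
    then have "tight_rank p u r h = 0" using hosp(2)[OF r] by simp
    then have "h \<le> p" by (auto simp: tight_rank_def split: if_splits)
    then have "card (ress_of (tight_matching l u) h) = u"
      using tight_loads(1) h by (simp add: tight_simps)
    then obtain r' where "r' \<in> residents I" "strictly_prefers (hosp_pref I h) r r'"
      using blk by (auto simp: blocks_def tight_simps(6) ress_of_tight)
    then show False using r by (auto simp: strictly_prefers_def tight_simps(1,7))
  qed
  ultimately show ?thesis by (simp add: stable_matching_def)
qed

text \<open>Each hospital of the first two tiers reaches the lower quota and scores 1; each of the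
  next \<open>p * u\<close> hospitals has one resident and scores \<open>1 / l\<close>.\<close>

lemma tight_score: "real (p + u) + real (p * u) / real l \<le> score I (tight_matching l u)"
proof -
  have "real (p + u) + real (p * u) / real l =
      (\<Sum>h\<in>{1..p + u}. 1) + (\<Sum>h\<in>{p + u + 1..p + u + p * u}. 1 / real l)"
    by simp
  also have "\<dots> = (\<Sum>h\<in>{1..p + u} \<union> {p + u + 1..p + u + p * u}. if h \<le> p + u then 1 else 1 / real l)"
    by (subst sum.union_disjoint) (auto intro!: arg_cong2[where f = "(+)"] sum.cong)
  also have "\<dots> \<le> (\<Sum>h\<in>{1..p + u} \<union> {p + u + 1..p + u + p * u}. hosp_score I (tight_matching l u) h)"
  proof (rule sum_mono)
    fix h assume h: "h \<in> {1..p + u} \<union> {p + u + 1..p + u + p * u}"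
    then consider "1 \<le> h" "h \<le> p" | "p < h" "h \<le> p + u" | "p + u < h" "h \<le> p + u + p * u" by force
    then show "(if h \<le> p + u then 1 else 1 / real l) \<le> hosp_score I (tight_matching l u) h"
      using tight_loads(1,2,3)[of h] l lu by cases (auto simp: hosp_score_def tight_simps(5))
  qed
  also have "\<dots> \<le> score I (tight_matching l u)"
    unfolding score_def by (rule sum_mono2) (auto simp: hosp_score_def tight_simps(2))
  finally show ?thesis .
qed

section \<open>The output on the tight instances\<close>

text \<open>Since every hospital is indifferent between all residents, a resident can only be kept out
  of full hospitals by residents of smaller index.\<close>

lemma tight_output_index:
  assumes "(r, h) \<in> double_proposal I" "k \<le> p + u + p * u"
    and better: "\<And>h'. h' \<in> {1..k} \<Longrightarrow> tight_rank p u r h' < tight_rank p u r h"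
  shows "k * u < r"
proof -
  let ?M = "double_proposal I"
  have M: "is_matching I ?M"
    using double_proposal_stable[OF tight_hrt_instance] by (simp add: stable_matching_def)
  then have rh: "r \<in> residents I" "h \<in> hospitals I" using assms(1) by (auto simp: is_matching_def)
  have sub: "{1..k} \<subseteq> hospitals I" using assms(2) by (auto simp: tight_simps)
  have prefers: "strictly_prefers (res_pref I r) h' h" if "h' \<in> {1..k}" for h'
    using better[OF that] that sub rh by (auto simp: tight_prefers)
  note full = double_proposal_better_full[OF tight_hrt_instance assms(1) _ prefers]
  \<comment> \<open>The \<open>k\<close> preferred hospitals are full, and their
    \<open>k * u\<close> residents all have indices below \<open>r\<close>.\<close>
  have "k * u = (\<Sum>h'\<in>{1..k}. card (ress_of ?M h'))"
    using full(1) sub by (simp add: tight_simps(6) subset_iff)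
  also have "\<dots> = card (\<Union>h'\<in>{1..k}. ress_of ?M h')" by (rule sum_loads_eq_card[OF M sub])
  also have "\<dots> \<le> card {1..<r}"
  proof (rule card_mono)
    show "(\<Union>h'\<in>{1..k}. ress_of ?M h') \<subseteq> {1..<r}"
    proof
      fix x assume "x \<in> (\<Union>h'\<in>{1..k}. ress_of ?M h')"
      then obtain h' where h': "h' \<in> {1..k}" "(x, h') \<in> ?M" by (auto simp: ress_of_def)
      then have "ranked_before I h' x r" using full(2) sub by blast
      moreover have "x \<in> residents I" using h' M by (auto simp: is_matching_def)
      ultimately show "x \<in> {1..<r}" using rh(1) by (auto simp: ranked_before_def tight_simps(1,7))
    qed
  qed simp
  also have "\<dots> < r" using rh(1) by (auto simp: tight_simps)
  finally show ?thesis .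
qed

text \<open>The third tier stays empty. A resident up to \<open>p * u\<close> ending there would
  need \<open>p * u\<close> predecessors filling the first tier; a later one would need
  \<open>(p + u) * u\<close> predecessors filling the first two.\<close>

lemma tight_ALG: "ALG I \<le> real (p + u)"
proof -
  let ?M = "double_proposal I"
  have low: "h \<le> p + u" if rh: "(r, h) \<in> ?M" for r h
  proof (rule ccontr)
    assume h: "\<not> h \<le> p + u"
    have r: "r \<in> residents I"
      using double_proposal_stable[OF tight_hrt_instance] rh
      by (auto simp: stable_matching_def is_matching_def)
    show False
    proof (cases "r \<le> p * u")
      case True
      have "p * u < r"
        by (rule tight_output_index[OF rh]) (use h in \<open>auto simp: tight_rank_def\<close>)
      then show False using True by simp
    next
      case False
      have "(p + u) * u < r"
        by (rule tight_output_index[OF rh]) (use h False in \<open>auto simp: tight_rank_def\<close>)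
      then show False using r by (simp add: tight_simps)
    qed
  qed
  have "ALG I \<le> (\<Sum>h\<in>hospitals I. if h \<le> p + u then 1 else 0)"
    unfolding ALG_def score_def
  proof (rule sum_mono)
    fix h
    have "ress_of ?M h = {}" if "\<not> h \<le> p + u" using low that by (auto simp: ress_of_def)
    then show "hosp_score I ?M h \<le> (if h \<le> p + u then 1 else 0)"
      using l by (auto simp: hosp_score_def tight_simps(5))
  qed
  also have "\<dots> = real (card (hospitals I \<inter> {h. h \<le> p + u}))"
    by (simp add: sum.If_cases)
  also have "hospitals I \<inter> {h. h \<le> p + u} = {1..p + u}" by (auto simp: tight_simps)
  finally show ?thesis by simp
qed

text \<open>Only this direction has to be computed; \<open>ratio_bound\<close> turns it into an
  equality.\<close>

lemma tight_ratio:
  "1 + real u * (real u - real l) / (real l * (2 * real u - real l)) \<le> OPT I / ALG I"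
proof -
  have p: "real p = real u - real l" using lu by (simp add: p_def of_nat_diff)
  have pos: "0 < real (p + u)" "0 < real l" using l lu by auto
  \<comment> \<open>Uses that \<open>p + u\<close> is \<open>2 * u - l\<close>.\<close>
  have "1 + real u * (real u - real l) / (real l * (2 * real u - real l)) =
      (real (p + u) + real (p * u) / real l) / real (p + u)"
  proof -
    have "1 + y * x / (z * w) = (w + x * y / z) / w" if "0 < w" "0 < z" for w x y z :: real
      using that by (simp add: field_simps)
    from this[OF pos, of "real u" "real p"] show ?thesis using p by (simp add: mult.commute)
  qed
  also have "\<dots> \<le> OPT I / real (p + u)"
    using tight_score score_le_OPT[OF tight_matching_stable] pos by (intro divide_right_mono) auto
  also have "\<dots> \<le> OPT I / ALG I"
  proof (rule divide_left_mono[OF tight_ALG])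
    have "0 \<le> real (p + u) + real (p * u) / real l" by simp
    then show "0 \<le> OPT I" using tight_score score_le_OPT[OF tight_matching_stable] by linarith
    show "0 < real (p + u) * ALG I" using pos ALG_pos[OF tight_uniform l] by simp
  qed
  finally show ?thesis .
qed

end

theorem theorem9:
  fixes l u :: nat and \<theta> :: real
  assumes "1 \<le> l" and "l \<le> u" and "\<theta> = real u / real l"
  shows "is_maximum_of ((\<theta>\<^sup>2 + \<theta> - 1) / (2 * \<theta> - 1))
           {OPT I / ALG I | I. uniform_instance l u I}"
proof -
  have pos: "0 < real l" "0 < 2 * real u - real l" using assms(1,2) by auto
  define c where "c = 1 + real u * (real u - real l) / (real l * (2 * real u - real l))"
  \<comment> \<open>Expanding the fraction by the square of \<open>l\<close> clears the denominators
    of \<theta>.\<close>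
  have "(\<theta>\<^sup>2 + \<theta> - 1) / (2 * \<theta> - 1) =
      ((\<theta>\<^sup>2 + \<theta> - 1) * (real l)\<^sup>2) / ((2 * \<theta> - 1) * (real l)\<^sup>2)"
    using pos by simp
  also have "(\<theta>\<^sup>2 + \<theta> - 1) * (real l)\<^sup>2 = (real u)\<^sup>2 + real u * real l - (real l)\<^sup>2"
    using pos by (simp add: assms(3) field_simps power2_eq_square)
  also have "(2 * \<theta> - 1) * (real l)\<^sup>2 = real l * (2 * real u - real l)"
    using pos by (simp add: assms(3) field_simps power2_eq_square)
  also have "((real u)\<^sup>2 + real u * real l - (real l)\<^sup>2) / (real l * (2 * real u - real l)) = c"
    using pos by (simp add: c_def field_simps power2_eq_square)
  finally have ratio: "(\<theta>\<^sup>2 + \<theta> - 1) / (2 * \<theta> - 1) = c" .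
  have upper: "OPT I / ALG I \<le> c" if "uniform_instance l u I" for I
    unfolding c_def by (rule ratio_bound[OF that assms(1,2)])
  have I: "uniform_instance l u (tight_instance l u)" by (rule tight_uniform[OF assms(1,2)])
  have "c \<le> OPT (tight_instance l u) / ALG (tight_instance l u)"
    unfolding c_def by (rule tight_ratio[OF assms(1,2)])
  with upper[OF I] have "c = OPT (tight_instance l u) / ALG (tight_instance l u)" by simp
  then show ?thesis unfolding ratio is_maximum_of_def using I upper by blast
qed

end
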